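(* Let $p,q\in\mathbb{F}$ be non-zero, let $\hat q=q-q^{-1}$, and let $\rho_p\in\operatorname{End}(V\otimes V)$ be the Cremmer-Gervais operator $$\rho_p(e_i\otimes e_j)=q\,p^{i-j}\,e_j\otimes e_i+\sum_k \hat q\,p^{i-k}\,\eta(i,j,k)\,e_k\otimes e_{i+j-k}.$$ Then the generating functions for the coefficients of $\rho_p$ are, for all $1\le i,j\le n$, $$G^{\rho_p}_{i,j}(x)=\frac{\hat q}{1-p^{-1}x}\,x^i+p^{i-j}\,\frac{q^{-1}-qp^{-1}x}{1-p^{-1}x}\,x^j .$$ In particular, in the case $p=1$ they become $$G^{\rho_1}_{i,j}(x)=\frac{\hat q}{1-x}\,x^i+\frac{q^{-1}-qx}{1-x}\,x^j .$$
   Context: $V$ is an $n$-dimensional vector space over a field $\mathbb{F}$ with basis $\{e_1,\dots,e_n\}$. An operator $\gamma\in\operatorname{End}(V\otimes V)$, $\gamma(e_i\otimes e_j)=\sum_{k,l}\gamma^{kl}_{ij}\,e_k\otimes e_l$, is called homogeneous if $\gamma^{kl}_{ij}\neq0$ only when $i+j=k+l$. In that case write $\gamma(i,j,k)=\gamma^{k,\,i+j-k}_{ij}$ (taken to be $0$ when $k$ or $i+j-k$ is not in $\{1,\dots,n\}$), so that $\gamma(e_i\otimes e_j)=\sum_k\gamma(i,j,k)\,e_k\otimes e_{i+j-k}$. The generating functions for the coefficients of $\gamma$ are the polynomials $G^\gamma_{i,j}(x)=\sum_k\gamma(i,j,k)x^k$, $1\le i,j\le n$. The function $\eta$ is defined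 by: $\eta(i,j,k)=1$ if $i\le k<j$; $\eta(i,j,k)=-1$ if $j\le k<i$; $\eta(i,j,k)=0$ otherwise. (The operator $\rho_p$ is homogeneous.) *)

theory Defs
  imports "HOL-Computational_Algebra.Computational_Algebra"
begin

definition bilinear_over ::
  "('f::field \<Rightarrow> 'v::ab_group_add \<Rightarrow> 'v) \<Rightarrow> ('f \<Rightarrow> 'u::ab_group_add \<Rightarrow> 'u) \<Rightarrow> ('v \<Rightarrow> 'v \<Rightarrow> 'u) \<Rightarrow> bool"
  where "bilinear_over sV sU b \<longleftrightarrow>
    (\<forall>v. Vector_Spaces.linear sV sU (\<lambda>w. b v w)) \<and> (\<forall>w. Vector_Spaces.linear sV sU (\<lambda>v. b v w))"

text \<open>
  The vector space with scalar multiplication \<open>scaleT\<close>, together with the bilinear map \<open>tens\<close>,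
  is a tensor square of the vector space with scalar multiplication \<open>scaleV\<close>.  HOL cannot quantify
  over the type of the target space in the universal property, so it is stated for scalar-valued
  bilinear forms. Over a field this is enough to determine the tensor square: uniqueness says that
  the pure tensors span, and existence that the canonical map from any tensor square is injective,
  because linear forms separate points.
\<close>
locale tensor_square = V: vector_space scaleV + T: vector_space scaleT
  for scaleV :: "'f::field \<Rightarrow> 'v::ab_group_add \<Rightarrow> 'v"
    and scaleT :: "'f \<Rightarrow> 't::ab_group_add \<Rightarrow> 't" +
  fixes tens :: "'v \<Rightarrow> 'v \<Rightarrow> 't"
  assumes bilinear_tens: "bilinear_over scaleV scaleT tens"
    and universal: "\<And>b :: 'v \<Rightarrow> 'v \<Rightarrow> 'f. bilinear_over scaleV (*) b \<Longrightarrow>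
      \<exists>!f. Vector_Spaces.linear scaleT (*) f \<and> (\<forall>v w. f (tens v w) = b v w)"

text \<open>The basis of the underlying space is the family \<open>e 1, \<dots>, e n\<close>; other values of \<open>e\<close> are junk.\<close>
locale based_tensor_square = tensor_square scaleV scaleT tens
  for scaleV :: "'f::field \<Rightarrow> 'v::ab_group_add \<Rightarrow> 'v"
    and scaleT :: "'f \<Rightarrow> 't::ab_group_add \<Rightarrow> 't"
    and tens :: "'v \<Rightarrow> 'v \<Rightarrow> 't" +
  fixes n :: nat and e :: "nat \<Rightarrow> 'v"
  assumes inj_e: "inj_on e {1..n}"
    and independent_e: "V.independent (e ` {1..n})"
    and span_e: "V.span (e ` {1..n}) = UNIV"

definition eta :: "nat \<Rightarrow> nat \<Rightarrow> nat \<Rightarrow> int" where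
  "eta i j k = (if i \<le> k \<and> k < j then 1 else if j \<le> k \<and> k < i then - 1 else 0)"

context based_tensor_square
begin

definition tensor_basis :: "'t set" where
  "tensor_basis = (\<lambda>(i, j). tens (e i) (e j)) ` ({1..n} \<times> {1..n})"

text \<open>\<open>coefficient \<gamma> i j k l\<close> is the matrix entry with lower indices \<open>i, j\<close> and upper indices \<open>k, l\<close>.\<close>
definition coefficient :: "('t \<Rightarrow> 't) \<Rightarrow> nat \<Rightarrow> nat \<Rightarrow> nat \<Rightarrow> nat \<Rightarrow> 'f" where
  "coefficient \<gamma> i j k l =
     T.representation tensor_basis (\<gamma> (tens (e i) (e j))) (tens (e k) (e l))"

definition homogeneous :: "('t \<Rightarrow> 't) \<Rightarrow> bool" where
  "homogeneous \<gamma> \<longleftrightarrow> (\<forall>i\<in>{1..n}. \<forall>j\<in>{1..n}. \<forall>k\<in>{1..n}. \<forall>l\<in>{1..n}.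
     coefficient \<gamma> i j k l \<noteq> 0 \<longrightarrow> i + j = k + l)"

text \<open>The truncation of \<open>i + j - k\<close> is harmless: a truncated value \<open>0\<close> is not in \<open>{1..n}\<close>.\<close>
definition hom_coefficient :: "('t \<Rightarrow> 't) \<Rightarrow> nat \<Rightarrow> nat \<Rightarrow> nat \<Rightarrow> 'f" where
  "hom_coefficient \<gamma> i j k =
     (if k \<in> {1..n} \<and> i + j - k \<in> {1..n} then coefficient \<gamma> i j k (i + j - k) else 0)"

definition generating_function :: "('t \<Rightarrow> 't) \<Rightarrow> nat \<Rightarrow> nat \<Rightarrow> 'f poly" where
  "generating_function \<gamma> i j = (\<Sum>k=1..n. monom (hom_coefficient \<gamma> i j k) k)"

text \<open>
  If \<open>i + j - k\<close> is not an index in \<open>{1..n}\<close>, then \<open>k\<close> does not lie between \<open>i\<close> and \<open>j\<close>, so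
  \<open>eta i j k = 0\<close> and the junk value of \<open>e\<close> does not matter.
\<close>
definition cremmer_gervais_image :: "'f \<Rightarrow> 'f \<Rightarrow> nat \<Rightarrow> nat \<Rightarrow> 't" where
  "cremmer_gervais_image q p i j =
     scaleT (q * p powi (int i - int j)) (tens (e j) (e i)) +
     (\<Sum>k=1..n. scaleT ((q - inverse q) * p powi (int i - int k) * of_int (eta i j k))
                  (tens (e k) (e (i + j - k))))"

definition cremmer_gervais :: "'f \<Rightarrow> 'f \<Rightarrow> 't \<Rightarrow> 't" where
  "cremmer_gervais q p = (THE \<rho>. Vector_Spaces.linear scaleT scaleT \<rho> \<and>
     (\<forall>i\<in>{1..n}. \<forall>j\<in>{1..n}. \<rho> (tens (e i) (e j)) = cremmer_gervais_image q p i j))"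

end

text \<open>
  The following facts show that the description above is well posed: the tensors \<open>e i \<otimes> e j\<close> form
  a basis, the Cremmer-Gervais operator exists and is unique, it is homogeneous, and the
  coefficients of a homogeneous operator determine its values on that basis.
\<close>

lemma vector_space_field: "vector_space ((*) :: 'f::field \<Rightarrow> 'f \<Rightarrow> 'f)"
  by unfold_locales (simp_all add: algebra_simps)

context based_tensor_square
begin

lemma tens_eval:
  assumes "k \<in> {1..n}" "l \<in> {1..n}"
  obtains f where "Vector_Spaces.linear scaleT (*) f"
    "\<And>i j. i \<in> {1..n} \<Longrightarrow> j \<in> {1..n} \<Longrightarrow> f (tens (e i) (e j)) = (if i = k \<and> j = l then 1 else 0)"
proof -
  let ?r = "V.representation (e ` {1..n})"
  define b where "b v w = ?r v (e k) * ?r w (e l)" for v w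
  note lin = V.linear_representation[OF independent_e span_e]
  have bil: "bilinear_over scaleV (*) b"
    using lin unfolding bilinear_over_def b_def Vector_Spaces.linear_iff
    by (simp add: distrib_left distrib_right mult.assoc mult.left_commute)
  obtain f where f: "Vector_Spaces.linear scaleT (*) f" "\<And>v w. f (tens v w) = b v w"
    using universal[OF bil] by blast
  have r: "?r (e i) (e k) = (if i = k then 1 else 0)" if "i \<in> {1..n}" "k \<in> {1..n}" for i k
    using V.representation_basis[OF independent_e, of "e i"] that inj_e
    by (auto simp: inj_on_eq_iff)
  show ?thesis
    by (rule that[of f]) (use f r assms in \<open>auto simp: b_def\<close>)
qed

lemma inj_tens: "inj_on (\<lambda>(i, j). tens (e i) (e j)) ({1..n} \<times> {1..n})"
proof (rule inj_onI, clarify)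
  fix i j k l
  assume h: "i \<in> {1..n}" "j \<in> {1..n}" "k \<in> {1..n}" "l \<in> {1..n}"
    "tens (e i) (e j) = tens (e k) (e l)"
  obtain f :: "'t \<Rightarrow> 'f" where
    "\<And>i j. i \<in> {1..n} \<Longrightarrow> j \<in> {1..n} \<Longrightarrow> f (tens (e i) (e j)) = (if i = k \<and> j = l then 1 else 0)"
    using tens_eval[OF h(3,4)] by blast
  from this[OF h(1,2)] this[OF h(3,4)] h(5) show "i = k \<and> j = l"
    by (auto split: if_splits)
qed

lemma tens_eq_iff:
  assumes "i \<in> {1..n}" "j \<in> {1..n}" "k \<in> {1..n}" "l \<in> {1..n}"
  shows "tens (e i) (e j) = tens (e k) (e l) \<longleftrightarrow> i = k \<and> j = l"
  using inj_on_eq_iff[OF inj_tens, of "(i, j)" "(k, l)"] assms by simp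

lemma independent_tensor_basis: "T.independent tensor_basis"
proof (rule T.independent_if_scalars_zero)
  show "finite tensor_basis" by (simp add: tensor_basis_def)
  fix c x assume s: "(\<Sum>x\<in>tensor_basis. scaleT (c x) x) = 0" and x: "x \<in> tensor_basis"
  obtain k l where kl: "k \<in> {1..n}" "l \<in> {1..n}" "x = tens (e k) (e l)"
    using x by (auto simp: tensor_basis_def)
  obtain f where f: "Vector_Spaces.linear scaleT (*) f"
    "\<And>i j. i \<in> {1..n} \<Longrightarrow> j \<in> {1..n} \<Longrightarrow> f (tens (e i) (e j)) = (if i = k \<and> j = l then 1 else 0)"
    using tens_eval[OF kl(1,2)] by blast
  interpret f: Vector_Spaces.linear scaleT "(*)" f by (rule f(1))
  have v: "f y = (if y = x then 1 else 0)" if y: "y \<in> tensor_basis" for y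
  proof -
    obtain i j where ij: "i \<in> {1..n}" "j \<in> {1..n}" "y = tens (e i) (e j)"
      using y by (auto simp: tensor_basis_def)
    show ?thesis using f(2)[OF ij(1,2)] tens_eq_iff[OF ij(1,2) kl(1,2)] ij(3) kl(3) by simp
  qed
  have "0 = f (\<Sum>x\<in>tensor_basis. scaleT (c x) x)" using s f.zero by simp
  also have "\<dots> = (\<Sum>y\<in>tensor_basis. c y * (if y = x then 1 else 0))"
    by (simp add: f.sum f.scale v)
  also have "\<dots> = c x" using x by (simp add: tensor_basis_def if_distrib cong: if_cong)
  finally show "c x = 0" by simp
qed

lemma tens_in_span: "tens v w \<in> T.span tensor_basis"
proof -
  interpret P: vector_space_pair scaleV scaleT ..
  have lin1: "Vector_Spaces.linear scaleV scaleT (\<lambda>w. tens v w)" for v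
    using bilinear_tens by (simp add: bilinear_over_def)
  have lin2: "Vector_Spaces.linear scaleV scaleT (\<lambda>v. tens v w)" for w
    using bilinear_tens by (simp add: bilinear_over_def)
  have span: "tens x y \<in> T.span (tens x ` (e ` {1..n}))" for x y
    using P.linear_span_image[OF lin1, of x "e ` {1..n}"] span_e by auto
  have span': "tens x y \<in> T.span ((\<lambda>x. tens x y) ` (e ` {1..n}))" for x y
    using P.linear_span_image[OF lin2, of y "e ` {1..n}"] span_e by auto
  have 1: "tens (e i) y \<in> T.span tensor_basis" if "i \<in> {1..n}" for i y
  proof -
    have "tens (e i) ` (e ` {1..n}) \<subseteq> tensor_basis"
      using that by (force simp: tensor_basis_def)
    from T.span_mono[OF this] span[of "e i" y] show ?thesis by blast
  qed
  have "(\<lambda>x. tens x w) ` (e ` {1..n}) \<subseteq> T.span tensor_basis" using 1 by auto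
  from T.span_mono[OF this] span'[of v w] show ?thesis by (auto simp: T.span_span)
qed

lemma span_tensor_basis: "T.span tensor_basis = UNIV"
proof (rule ccontr)
  assume "T.span tensor_basis \<noteq> UNIV"
  then obtain x where x: "x \<notin> T.span tensor_basis" by blast
  then have ind: "T.independent (insert x tensor_basis)"
    using independent_tensor_basis by (simp add: T.independent_insert T.span_base)
  interpret K: vector_space "(*) :: 'f \<Rightarrow> 'f \<Rightarrow> 'f" by (rule vector_space_field)
  interpret P: vector_space_pair scaleT "(*) :: 'f \<Rightarrow> 'f \<Rightarrow> 'f" ..
  define f where "f = P.construct (insert x tensor_basis) (\<lambda>b. if b = x then 1 else 0)"
  have lf: "Vector_Spaces.linear scaleT (*) f" unfolding f_def by (rule P.linear_construct[OF ind])
  have fx: "f x = 1" unfolding f_def by (subst P.construct_basis[OF ind]) auto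
  have fb: "f b = 0" if "b \<in> tensor_basis" for b
    unfolding f_def using that x T.span_base[of b tensor_basis]
    by (subst P.construct_basis[OF ind]) auto
  have l0: "Vector_Spaces.linear scaleT (*) (\<lambda>_. 0 :: 'f)" by (rule P.linear_zero)
  have f0: "f (tens v w) = 0" for v w
    using P.linear_eq_on[OF lf l0 tens_in_span, of v w] fb by blast
  have "bilinear_over scaleV (*) (\<lambda>_ _. 0 :: 'f)"
    by (simp add: bilinear_over_def Vector_Spaces.linear_iff V.vector_space_axioms K.vector_space_axioms)
  from universal[OF this] lf l0 f0 have "f = (\<lambda>_. 0)" by blast
  with fx show False by simp
qed

lemma ex1_linear_extension:
  "\<exists>!\<rho>. Vector_Spaces.linear scaleT scaleT \<rho> \<and>
     (\<forall>i\<in>{1..n}. \<forall>j\<in>{1..n}. \<rho> (tens (e i) (e j)) = g i j)"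
proof -
  interpret P: vector_space_pair scaleT scaleT ..
  let ?h = "\<lambda>(i, j). tens (e i) (e j)"
  define g' where "g' b = (case the_inv_into ({1..n} \<times> {1..n}) ?h b of (i, j) \<Rightarrow> g i j)" for b
  have g': "g' (tens (e i) (e j)) = g i j" if "i \<in> {1..n}" "j \<in> {1..n}" for i j
    using the_inv_into_f_f[OF inj_tens, of "(i, j)"] that by (simp add: g'_def)
  show ?thesis
  proof (rule ex1I[of _ "P.construct tensor_basis g'"], intro conjI ballI)
    show "Vector_Spaces.linear scaleT scaleT (P.construct tensor_basis g')"
      by (rule P.linear_construct[OF independent_tensor_basis])
    fix i j assume ij: "i \<in> {1..n}" "j \<in> {1..n}"
    then have "tens (e i) (e j) \<in> tensor_basis" by (auto simp: tensor_basis_def)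
    then show "P.construct tensor_basis g' (tens (e i) (e j)) = g i j"
      using g'[OF ij] by (simp add: P.construct_basis[OF independent_tensor_basis])
  next
    fix \<rho> assume \<rho>: "Vector_Spaces.linear scaleT scaleT \<rho> \<and>
      (\<forall>i\<in>{1..n}. \<forall>j\<in>{1..n}. \<rho> (tens (e i) (e j)) = g i j)"
    have eq: "\<rho> b = P.construct tensor_basis g' b" if b: "b \<in> tensor_basis" for b
    proof -
      obtain i j where ij: "i \<in> {1..n}" "j \<in> {1..n}" "b = tens (e i) (e j)"
        using b by (auto simp: tensor_basis_def)
      then show ?thesis
        using \<rho> g'[OF ij(1,2)] P.construct_basis[OF independent_tensor_basis b, of g'] by simp
    qed
    show "\<rho> = P.construct tensor_basis g'"
    proof
      fix x
      have "x \<in> T.span tensor_basis" by (simp add: span_tensor_basis)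
      from P.linear_eq_on[OF conjunct1[OF \<rho>] P.linear_construct[OF independent_tensor_basis] this eq]
      show "\<rho> x = P.construct tensor_basis g' x" .
    qed
  qed
qed

lemma linear_cremmer_gervais: "Vector_Spaces.linear scaleT scaleT (cremmer_gervais q p)"
  and cremmer_gervais_tens:
    "i \<in> {1..n} \<Longrightarrow> j \<in> {1..n} \<Longrightarrow>
      cremmer_gervais q p (tens (e i) (e j)) = cremmer_gervais_image q p i j"
  using theI'[OF ex1_linear_extension[of "cremmer_gervais_image q p"]]
  unfolding cremmer_gervais_def by blast+

lemma representation_tens:
  assumes "i \<in> {1..n}" "j \<in> {1..n}" "k \<in> {1..n}" "l \<in> {1..n}"
  shows "T.representation tensor_basis (tens (e i) (e j)) (tens (e k) (e l)) =
    (if i = k \<and> j = l then 1 else 0)"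
proof -
  have "tens (e i) (e j) \<in> tensor_basis" using assms by (auto simp: tensor_basis_def)
  then show ?thesis
    using T.representation_basis[OF independent_tensor_basis, of "tens (e i) (e j)"]
      tens_eq_iff[OF assms] by auto
qed

lemma homogeneous_cremmer_gervais: "homogeneous (cremmer_gervais q p)"
  unfolding homogeneous_def
proof (intro ballI impI)
  fix i j k l assume h: "i \<in> {1..n}" "j \<in> {1..n}" "k \<in> {1..n}" "l \<in> {1..n}"
    and nz: "coefficient (cremmer_gervais q p) i j k l \<noteq> 0"
  let ?r = "\<lambda>x. T.representation tensor_basis x (tens (e k) (e l))"
  interpret r: Vector_Spaces.linear scaleT "(*)" ?r
    by (rule T.linear_representation[OF independent_tensor_basis span_tensor_basis])
  show "i + j = k + l"
  proof (rule ccontr)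
    assume ne: "i + j \<noteq> k + l"
    have z: "of_int (eta i j m) * ?r (tens (e m) (e (i + j - m))) = 0" if m: "m \<in> {1..n}" for m
    proof (cases "eta i j m = 0")
      case False
      then have "i + j - m \<in> {1..n}" "m \<le> i + j" using h by (auto simp: eta_def split: if_splits)
      then show ?thesis using representation_tens[OF m _ h(3,4), of "i + j - m"] ne by auto
    qed simp
    have swap: "?r (tens (e j) (e i)) = 0"
      unfolding representation_tens[OF h(2,1,3,4)] using ne by auto
    have "?r (cremmer_gervais_image q p i j) =
      (\<Sum>m=1..n. (q - inverse q) * p powi (int i - int m) * of_int (eta i j m) *
        ?r (tens (e m) (e (i + j - m))))"
      unfolding cremmer_gervais_image_def r.add r.sum r.scale swap by (simp only: mult_zero_right add_0)
    also have "\<dots> = 0" by (rule sum.neutral) (use z in \<open>auto simp only: mult.assoc mult_zero_right\<close>)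
    finally have "?r (cremmer_gervais_image q p i j) = 0" .
    then show False using nz unfolding coefficient_def cremmer_gervais_tens[OF h(1,2)] by contradiction
  qed
qed

lemma homogeneous_expansion:
  assumes "homogeneous \<gamma>" "i \<in> {1..n}" "j \<in> {1..n}"
  shows "\<gamma> (tens (e i) (e j)) =
    (\<Sum>k=1..n. scaleT (hom_coefficient \<gamma> i j k) (tens (e k) (e (i + j - k))))"
proof -
  let ?x = "\<gamma> (tens (e i) (e j))"
  have fin: "finite tensor_basis" by (simp add: tensor_basis_def)
  have "?x = (\<Sum>b\<in>tensor_basis. scaleT (T.representation tensor_basis ?x b) b)"
    using T.sum_representation_eq[OF independent_tensor_basis _ fin order_refl, of ?x]
      span_tensor_basis by simp
  also have "\<dots> = (\<Sum>(k, l)\<in>{1..n} \<times> {1..n}. scaleT (coefficient \<gamma> i j k l) (tens (e k) (e l)))"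
    unfolding tensor_basis_def
    by (subst sum.reindex[OF inj_tens]) (simp add: coefficient_def tensor_basis_def case_prod_unfold)
  also have "\<dots> = (\<Sum>k=1..n. \<Sum>l=1..n. scaleT (coefficient \<gamma> i j k l) (tens (e k) (e l)))"
    by (simp add: sum.cartesian_product)
  also have "\<dots> = (\<Sum>k=1..n. scaleT (hom_coefficient \<gamma> i j k) (tens (e k) (e (i + j - k))))"
  proof (rule sum.cong[OF refl])
    fix k assume k: "k \<in> {1..n}"
    have z: "coefficient \<gamma> i j k l = 0" if "l \<in> {1..n}" "l \<noteq> i + j - k" for l
      using assms k that unfolding homogeneous_def by fastforce
    have "(\<Sum>l=1..n. scaleT (coefficient \<gamma> i j k l) (tens (e k) (e l))) =
      (\<Sum>l=1..n. if l = i + j - k then scaleT (coefficient \<gamma> i j k l) (tens (e k) (e l)) else 0)"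
      by (rule sum.cong) (auto simp: z)
    also have "\<dots> = scaleT (hom_coefficient \<gamma> i j k) (tens (e k) (e (i + j - k)))"
      using k by (simp add: hom_coefficient_def sum.delta)
    finally show "(\<Sum>l=1..n. scaleT (coefficient \<gamma> i j k l) (tens (e k) (e l))) =
      scaleT (hom_coefficient \<gamma> i j k) (tens (e k) (e (i + j - k)))" .
  qed
  finally show ?thesis .
qed

end

text \<open>
  Identities between generating functions hold in the field of rational functions:
  \<open>rat_const c\<close> is the constant \<open>c\<close>, \<open>rat_X\<close> the indeterminate, \<open>to_fract\<close> the embedding of polynomials.
\<close>
abbreviation rat_const :: "'f::field \<Rightarrow> 'f poly fract" where
  "rat_const c \<equiv> to_fract [:c:]"

abbreviation rat_X :: "'f::field poly fract" where
  "rat_X \<equiv> to_fract [:0, 1:]"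

end

theory Submission
  imports Defs
begin

text \<open>
  The coefficient of \<open>\<rho>\<^sub>p\<close> at \<open>x ^ k\<close> is \<open>(q - inverse q) * p ^ (i - k) * eta i j k\<close>, with an extra
  \<open>q * p ^ (i - j)\<close> at \<open>k = j\<close> (\<open>hom_coefficient_cremmer_gervais\<close>). Since \<open>eta i j k\<close> is the
  difference of the indicators of \<open>i \<le> k\<close> and \<open>j \<le> k\<close>, the sum of the \<open>p ^ (i - k) * eta i j k * x ^ k\<close>
  is, up to the factor \<open>p ^ i\<close>, a difference of two geometric progressions in \<open>y = x / p\<close>, one running
  from \<open>i\<close> and one from \<open>j\<close> to the common end \<open>n\<close>. Multiplying by \<open>1 - y\<close> leaves \<open>y ^ i - y ^ j\<close>
  whatever the order of \<open>i\<close> and \<open>j\<close> (\<open>geometric_sum_eta\<close>), so that, with \<open>y ^ i = x ^ i / p ^ i\<close>,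
  \[
    (1 - y)\, G_{i,j}(x) = (q - q^{-1})\,(x^i - p^{i-j} x^j) + q\, p^{i-j}\,(1 - y)\, x^j .
  \]
  The contributions of \<open>q\<close> to the constant factor of \<open>x ^ j\<close> cancel, because
  \<open>q - (q - inverse q) = inverse q\<close>. Dividing by \<open>1 - y\<close> gives the formula; the case \<open>p = 1\<close> is a
  specialization.
\<close>

lemma of_int_eta: "of_int (eta i j k) = (of_bool (i \<le> k) - of_bool (j \<le> k) :: 'a::ring_1)"
  by (simp add: eta_def)

text \<open>Both progressions stop at the same \<open>n\<close>, so their end terms \<open>y ^ Suc n\<close> cancel.\<close>
lemma geometric_sum_eta:
  fixes y :: "'a::comm_ring_1"
  assumes "i \<in> {1..n}" "j \<in> {1..n}"
  shows "(1 - y) * (\<Sum>k=1..n. of_int (eta i j k) * y ^ k) = y ^ i - y ^ j"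
proof -
  have tail: "(1 - y) * (\<Sum>k=1..n. of_bool (a \<le> k) * y ^ k) = y ^ a - y ^ Suc n"
    if "a \<in> {1..n}" for a
  proof -
    have "(\<Sum>k=1..n. of_bool (a \<le> k) * y ^ k) = (\<Sum>k=a..n. y ^ k)"
      by (rule sum.mono_neutral_cong_right) (use that in auto)
    then show ?thesis using sum_gp_multiplied[of a n y] that by simp
  qed
  show ?thesis
    using tail[OF assms(1)] tail[OF assms(2)]
    by (simp add: of_int_eta left_diff_distrib[of "of_bool _"] sum_subtractf right_diff_distrib[of "1 - y"])
qed

lemma power_int_diff_eq_power_inverse:
  fixes p :: "'f::field"
  assumes "p \<noteq> 0"
  shows "p powi (int i - int k) = p ^ i * inverse p ^ k"
  using assms by (simp add: power_int_diff power_inverse divide_inverse)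

context based_tensor_square
begin

text \<open>
  If \<open>i + j - k\<close> is not an index, the left side is \<open>0\<close> by convention; the right side agrees because
  \<open>k\<close> is then neither \<open>j\<close> nor between \<open>i\<close> and \<open>j\<close>. Otherwise the coefficient is read off by the
  linear functional dual to \<open>tens (e k) (e (i + j - k))\<close>, which keeps only the summand of index \<open>k\<close>
  and, for \<open>k = j\<close>, the swapped tensor.
\<close>
lemma hom_coefficient_cremmer_gervais:
  assumes i: "i \<in> {1..n}" and j: "j \<in> {1..n}" and k: "k \<in> {1..n}"
  shows "hom_coefficient (cremmer_gervais q p) i j k =
    of_bool (k = j) * (q * p powi (int i - int j)) +
    (q - inverse q) * p powi (int i - int k) * of_int (eta i j k)"
proof (cases "i + j - k \<in> {1..n}")
  case False
  then have "eta i j k = 0" "k \<noteq> j" using assms by (auto simp: eta_def)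
  then show ?thesis using False by (auto simp: hom_coefficient_def)
next
  case l: True
  let ?r = "\<lambda>x. T.representation tensor_basis x (tens (e k) (e (i + j - k)))"
  let ?c = "\<lambda>m. (q - inverse q) * p powi (int i - int m) * of_int (eta i j m)"
  interpret r: Vector_Spaces.linear scaleT "(*)" ?r
    by (rule T.linear_representation[OF independent_tensor_basis span_tensor_basis])
  have swap: "?r (tens (e j) (e i)) = of_bool (k = j)"
    using representation_tens[OF j i k l] by auto
  have m: "?c m * ?r (tens (e m) (e (i + j - m))) = (if m = k then ?c m else 0)"
    if m: "m \<in> {1..n}" for m
  proof (cases "eta i j m = 0")
    case False
    \<comment> \<open>A nonzero \<open>eta i j m\<close> puts \<open>m\<close> between \<open>i\<close> and \<open>j\<close>, so the second index is genuine.\<close>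
    then have "i + j - m \<in> {1..n}" using i j by (auto simp: eta_def split: if_splits)
    then show ?thesis using representation_tens[OF m _ k l, of "i + j - m"] by auto
  next
    case True
    then have "?c m = 0" by simp
    then show ?thesis by (simp only: mult_zero_left if_cancel)
  qed
  have "hom_coefficient (cremmer_gervais q p) i j k = ?r (cremmer_gervais_image q p i j)"
    using k l unfolding hom_coefficient_def coefficient_def cremmer_gervais_tens[OF i j] by simp
  also have "\<dots> = q * p powi (int i - int j) * of_bool (k = j) + (\<Sum>m=1..n. if m = k then ?c m else 0)"
    unfolding cremmer_gervais_image_def r.add r.sum r.scale swap using m
    by (intro arg_cong2[of _ _ _ _ "(+)"] refl sum.cong)
  also have "(\<Sum>m=1..n. if m = k then ?c m else 0) = ?c k"
    using k by (simp add: sum.delta)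
  finally show ?thesis by (simp only: mult.commute)
qed

text \<open>With the denominator cleared the formula is an identity of polynomials, where the geometric sums live.\<close>
lemma generating_function_cremmer_gervais:
  assumes p: "p \<noteq> 0" and i: "i \<in> {1..n}" and j: "j \<in> {1..n}"
  shows "(1 - [:inverse p:] * [:0, 1:]) * generating_function (cremmer_gervais q p) i j =
    [:q - inverse q:] * [:0, 1:] ^ i +
    [:p powi (int i - int j):] * ([:inverse q:] - [:q * inverse p:] * [:0, 1:]) * [:0, 1:] ^ j"
proof -
  define X where "X = ([:0, 1:] :: 'f poly)"
  define y where "y = [:inverse p:] * X"
  let ?c = "[:p powi (int i - int j):]"
  have monom: "monom c k = [:c:] * X ^ k" for c :: 'f and k
    by (simp add: X_def monom_altdef)
  have const: "[:a * b:] = [:a:] * [:b:]" "[:a - b:] = [:a:] - [:b:]" "[:a ^ m:] = [:a:] ^ m"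
    for a b :: 'f and m
    by (simp_all add: poly_const_pow)
  have pyX: "[:p ^ i:] * y ^ k = [:p powi (int i - int k):] * X ^ k" for k
    unfolding power_int_diff_eq_power_inverse[OF p] y_def const power_mult_distrib
    by (simp only: mult.assoc)
  have term_eq: "monom (hom_coefficient (cremmer_gervais q p) i j k) k =
      of_bool (k = j) * ([:q:] * ?c * X ^ j) +
      [:q - inverse q:] * [:p ^ i:] * (of_int (eta i j k) * y ^ k)" if k: "k \<in> {1..n}" for k
  proof -
    have "[:q - inverse q:] * [:p ^ i:] * (of_int (eta i j k) * y ^ k) =
        [:q - inverse q:] * ([:p ^ i:] * y ^ k) * of_int (eta i j k)"
      by (simp only: mult_ac)
    also have "\<dots> = monom ((q - inverse q) * p powi (int i - int k) * of_int (eta i j k)) k"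
      unfolding pyX unfolding monom const of_int_poly by (simp only: mult_ac)
    finally show ?thesis
      unfolding hom_coefficient_cremmer_gervais[OF i j k] add_monom[symmetric]
      by (cases "k = j") (simp_all add: monom_eq_0 monom[of "q * _", unfolded const(1)])
  qed
  have pick: "(\<Sum>k=1..n. of_bool (k = j) * c) = c" for c :: "'f poly"
    using j by (simp add: of_bool_def if_distrib[of "\<lambda>a. a * c"] cong: if_cong)
  have "generating_function (cremmer_gervais q p) i j =
      (\<Sum>k=1..n. of_bool (k = j) * ([:q:] * ?c * X ^ j)) +
      [:q - inverse q:] * [:p ^ i:] * (\<Sum>k=1..n. of_int (eta i j k) * y ^ k)"
    unfolding generating_function_def sum_distrib_left sum.distrib[symmetric]
    by (rule sum.cong[OF refl term_eq])
  also have "(\<Sum>k=1..n. of_bool (k = j) * ([:q:] * ?c * X ^ j)) = [:q:] * ?c * X ^ j"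
    by (rule pick)
  finally have "(1 - y) * generating_function (cremmer_gervais q p) i j =
      (1 - y) * ([:q:] * ?c * X ^ j) + [:q - inverse q:] * [:p ^ i:] *
      ((1 - y) * (\<Sum>k=1..n. of_int (eta i j k) * y ^ k))"
    by (simp only: distrib_left mult_ac)
  also have "\<dots> = (1 - y) * ([:q:] * ?c * X ^ j) +
      [:q - inverse q:] * ([:p ^ i:] * y ^ i - [:p ^ i:] * y ^ j)"
    unfolding geometric_sum_eta[OF i j] by (simp only: mult.assoc right_diff_distrib)
  also have "\<dots> = (1 - y) * ([:q:] * ?c * X ^ j) + [:q - inverse q:] * (X ^ i - ?c * X ^ j)"
    unfolding pyX by (simp add: pCons_one)
  also have "\<dots> = [:q - inverse q:] * X ^ i + ?c * ([:inverse q:] - [:q * inverse p:] * X) * X ^ j"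
    unfolding y_def const by (simp only: ring_distribs mult_ac mult_1_left mult_1_right) (simp only: algebra_simps)
  finally show ?thesis unfolding y_def X_def .
qed

lemma to_fract_generating_function_cremmer_gervais:
  assumes p: "p \<noteq> 0" and i: "i \<in> {1..n}" and j: "j \<in> {1..n}"
  shows "to_fract (generating_function (cremmer_gervais q p) i j) =
    rat_const (q - inverse q) / (1 - rat_const (inverse p) * rat_X) * rat_X ^ i
    + rat_const (p powi (int i - int j))
      * ((rat_const (inverse q) - rat_const (q * inverse p) * rat_X)
         / (1 - rat_const (inverse p) * rat_X)) * rat_X ^ j"
proof -
  let ?G = "generating_function (cremmer_gervais q p) i j"
  let ?d = "1 - rat_const (inverse p) * rat_X"
  have pow: "to_fract (a ^ m) = to_fract a ^ m" for a :: "'f poly" and m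
    by (induction m) simp_all
  have "1 - [:inverse p:] * [:0, 1:] \<noteq> (0 :: 'f poly)"
    by (simp add: one_pCons)
  then have "to_fract (1 - [:inverse p:] * [:0, 1:]) \<noteq> 0"
    by (simp only: to_fract_eq_0_iff not_False_eq_True)
  then have nz: "?d \<noteq> 0" by (simp only: to_fract_diff to_fract_mult to_fract_1 not_False_eq_True)
  have "?d * to_fract ?G = rat_const (q - inverse q) * rat_X ^ i +
    rat_const (p powi (int i - int j)) *
      (rat_const (inverse q) - rat_const (q * inverse p) * rat_X) * rat_X ^ j"
    using arg_cong[OF generating_function_cremmer_gervais[OF assms, of q], of to_fract]
    by (simp only: to_fract_diff to_fract_mult to_fract_add to_fract_1 pow)
  from this[symmetric] have "to_fract ?G = (rat_const (q - inverse q) * rat_X ^ i +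
    rat_const (p powi (int i - int j)) *
      (rat_const (inverse q) - rat_const (q * inverse p) * rat_X) * rat_X ^ j) / ?d"
    using nz by (simp only: nonzero_mult_div_cancel_left not_False_eq_True)
  then show ?thesis by (simp only: add_divide_distrib times_divide_eq_left times_divide_eq_right)
qed

end

theorem lemma2p1:
  fixes scaleV :: "'f::field \<Rightarrow> 'v::ab_group_add \<Rightarrow> 'v"
    and scaleT :: "'f \<Rightarrow> 't::ab_group_add \<Rightarrow> 't"
    and tens :: "'v \<Rightarrow> 'v \<Rightarrow> 't"
    and n :: nat and e :: "nat \<Rightarrow> 'v"
    and p q :: 'f
  assumes "based_tensor_square scaleV scaleT tens n e"
    and "p \<noteq> 0" and "q \<noteq> 0"
  shows "(\<forall>i\<in>{1..n}. \<forall>j\<in>{1..n}.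
      to_fract (based_tensor_square.generating_function scaleT tens n e
          (based_tensor_square.cremmer_gervais scaleT tens n e q p) i j) =
        rat_const (q - inverse q) / (1 - rat_const (inverse p) * rat_X) * rat_X ^ i
        + rat_const (p powi (int i - int j))
          * ((rat_const (inverse q) - rat_const (q * inverse p) * rat_X)
             / (1 - rat_const (inverse p) * rat_X)) * rat_X ^ j)
    \<and> (\<forall>i\<in>{1..n}. \<forall>j\<in>{1..n}.
      to_fract (based_tensor_square.generating_function scaleT tens n e
          (based_tensor_square.cremmer_gervais scaleT tens n e q 1) i j) =
        rat_const (q - inverse q) / (1 - rat_X) * rat_X ^ i
        + (rat_const (inverse q) - rat_const q * rat_X) / (1 - rat_X) * rat_X ^ j)"
proof -
  interpret based_tensor_square scaleV scaleT tens n e by (rule assms(1))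
  have one: "rat_const 1 = (1 :: 'f poly fract)"
    by (simp add: pCons_one)
  show ?thesis
    using to_fract_generating_function_cremmer_gervais[OF assms(2), of _ _ q]
      to_fract_generating_function_cremmer_gervais[OF one_neq_zero, of _ _ q,
        unfolded inverse_1 power_int_1_left mult_1_right one mult_1_left]
    by (intro conjI ballI) assumption+
qed

end
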